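(* Let $y\in W^{1,1}(0,T;Y)$ be such that $F(y)=0$. Then $$\max_{t\in[0,T]}\phi\big(y(t)-v(t)\big)\le F(v)\qquad\forall v\in W^{1,1}(0,T;Y).$$
   Context: Let $T>0$ and let $Y$ be a separable reflexive real Banach space with norm $|\cdot|$, dual $Y^*$, and duality pairing $\langle\cdot,\cdot\rangle$ between $Y^*$ and $Y$. Let $\psi:Y\to[0,\infty]$ be proper, convex, lower semicontinuous and positively $1$-homogeneous; $C=D(\psi)=\{y:\psi(y)<\infty\}$; $\psi^*(w)=\sup_{v\in Y}(\langle w,v\rangle-\psi(v))$ is the conjugate, i.e. the indicator function of the closed convex set $C^*=\partial\psi(0)\subset Y^*$. Let $A:Y\to Y^*$ be linear, continuous and symmetric, $\phi(y)=\frac12\langle Ay,y\rangle$, and assume there is $\alpha>0$ with $\phi(y)\ge\frac{\alpha}{2}|y|^2$ for all $y\in C$. Let $\chi(y)=\phi(y)+|y|^2$, and assume $\chi\ge 0$ on $Y$ with $\chi(y)=0$ iff $y=0$. Let $\ell\in L^\infty(0,T;Y^* )$ and $y_0\in C$. Define $F:W^{1,1}(0,T;Y)\to[0,\infty]$ by $$F(y)=\int_0^T\big(\psi(y')+\psi^*(\ell-Ay)-\langle\ell-Ay,y'\rangle\big)\,dt+\chi(y(0)-y_0).$$ *)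

theory Defs
  imports "HOL-Analysis.Analysis"
begin

text \<open>The dual of \<open>'a\<close> is the type \<open>'a \<Rightarrow>\<^sub>L real\<close>, and the duality pairing of \<open>w\<close> and \<open>v\<close> is
  \<open>blinfun_apply w v\<close>.\<close>

definition reflexive_banach :: "'a::banach itself \<Rightarrow> bool" where
  "reflexive_banach _ \<longleftrightarrow>
     (\<forall>\<Theta> :: ('a \<Rightarrow>\<^sub>L real) \<Rightarrow>\<^sub>L real. \<exists>y. \<forall>w. blinfun_apply \<Theta> w = blinfun_apply w y)"

definition eff_dom :: "('a \<Rightarrow> ereal) \<Rightarrow> 'a set" where
  "eff_dom \<psi> = {y. \<psi> y < \<infinity>}"

definition proper :: "('a \<Rightarrow> ereal) \<Rightarrow> bool" where
  "proper \<psi> \<longleftrightarrow> eff_dom \<psi> \<noteq> {} \<and> (\<forall>y. \<psi> y \<noteq> -\<infinity>)"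

definition ereal_convex :: "('a::real_vector \<Rightarrow> ereal) \<Rightarrow> bool" where
  "ereal_convex \<psi> \<longleftrightarrow>
     (\<forall>x y. \<forall>u>0. \<forall>v>0. u + v = 1 \<longrightarrow>
        \<psi> (u *\<^sub>R x + v *\<^sub>R y) \<le> ereal u * \<psi> x + ereal v * \<psi> y)"

definition lower_semicontinuous :: "('a::topological_space \<Rightarrow> ereal) \<Rightarrow> bool" where
  "lower_semicontinuous \<psi> \<longleftrightarrow> (\<forall>x. \<psi> x \<le> Liminf (at x) \<psi>)"

definition pos_homogeneous :: "('a::real_vector \<Rightarrow> ereal) \<Rightarrow> bool" where
  "pos_homogeneous \<psi> \<longleftrightarrow> (\<forall>c>0. \<forall>y. \<psi> (c *\<^sub>R y) = ereal c * \<psi> y)"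

definition conjugate :: "('a::real_normed_vector \<Rightarrow> ereal) \<Rightarrow> ('a \<Rightarrow>\<^sub>L real) \<Rightarrow> ereal" where
  "conjugate \<psi> w = (SUP v. ereal (blinfun_apply w v) - \<psi> v)"

definition symmetric_op :: "('a::real_normed_vector \<Rightarrow>\<^sub>L ('a \<Rightarrow>\<^sub>L real)) \<Rightarrow> bool" where
  "symmetric_op A \<longleftrightarrow>
     (\<forall>x y. blinfun_apply (blinfun_apply A x) y = blinfun_apply (blinfun_apply A y) x)"

definition energy :: "('a::real_normed_vector \<Rightarrow>\<^sub>L ('a \<Rightarrow>\<^sub>L real)) \<Rightarrow> 'a \<Rightarrow> real" where
  "energy A y = blinfun_apply (blinfun_apply A y) y / 2"

definition chi :: "('a::real_normed_vector \<Rightarrow>\<^sub>L ('a \<Rightarrow>\<^sub>L real)) \<Rightarrow> 'a \<Rightarrow> real" where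
  "chi A y = energy A y + (norm y)\<^sup>2"

text \<open>If the dual is separable, as it is for a separable reflexive space, Borel measurability
  coincides with strong (Bochner) measurability.\<close>

definition Linf :: "real \<Rightarrow> (real \<Rightarrow> 'b::real_normed_vector) set" where
  "Linf T = {l. l \<in> borel_measurable (lebesgue_on {0..T}) \<and>
                (\<exists>M. AE t in lebesgue_on {0..T}. norm (l t) \<le> M)}"

text \<open>Elements of \<open>W\<^sup>1\<^sup>,\<^sup>1(0,T;Y)\<close> are given by their continuous representatives on \<open>{0..T}\<close>,
  that is, as primitives of Bochner integrable functions; values outside \<open>{0..T}\<close> are irrelevant.\<close>

definition is_W11_deriv ::
  "real \<Rightarrow> (real \<Rightarrow> 'a::{banach, second_countable_topology}) \<Rightarrow> (real \<Rightarrow> 'a) \<Rightarrow> bool" where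
  "is_W11_deriv T y g \<longleftrightarrow>
     integrable (lebesgue_on {0..T}) g \<and>
     (\<forall>t\<in>{0..T}. y t = y 0 + (\<integral>s. g s \<partial>lebesgue_on {0..t}))"

definition W11 :: "real \<Rightarrow> (real \<Rightarrow> 'a::{banach, second_countable_topology}) set" where
  "W11 T = {y. \<exists>g. is_W11_deriv T y g}"

text \<open>The derivative is determined only up to null sets; an arbitrary representative is chosen.\<close>

definition W11_deriv ::
  "real \<Rightarrow> (real \<Rightarrow> 'a::{banach, second_countable_topology}) \<Rightarrow> real \<Rightarrow> 'a" where
  "W11_deriv T y = (SOME g. is_W11_deriv T y g)"

text \<open>For \<open>\<psi> \<ge> 0\<close> proper, the integrand never contains \<open>\<infinity> - \<infinity>\<close> and is nonnegative by the
  Fenchel--Young inequality, so \<^const>\<open>e2ennreal\<close> does not truncate it.\<close>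

definition BE_functional ::
  "real \<Rightarrow> ('a::{banach, second_countable_topology} \<Rightarrow> ereal) \<Rightarrow> ('a \<Rightarrow>\<^sub>L ('a \<Rightarrow>\<^sub>L real)) \<Rightarrow>
   (real \<Rightarrow> ('a \<Rightarrow>\<^sub>L real)) \<Rightarrow> 'a \<Rightarrow> (real \<Rightarrow> 'a) \<Rightarrow> ereal" where
  "BE_functional T \<psi> A l y0 y =
     enn2ereal (\<integral>\<^sup>+ t. e2ennreal
         (\<psi> (W11_deriv T y t) + conjugate \<psi> (l t - blinfun_apply A (y t))
          - ereal (blinfun_apply (l t - blinfun_apply A (y t)) (W11_deriv T y t)))
       \<partial>lebesgue_on {0..T})
     + ereal (chi A (y 0 - y0))"

end

theory Submission
  imports Defs
begin

text \<open>Since \<open>F(y) = 0\<close>, we have \<open>y(0) = y0\<close> and, for almost every \<open>t\<close>, \<open>l - A y \<in> C\<^sup>*\<close> and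
  \<open>\<psi>(y') = \<langle>l - A y, y'\<rangle>\<close>. If \<open>l - A v \<in> C\<^sup>*\<close> and \<open>\<psi>(v') < \<infinity>\<close>, expand
  \<open>(\<phi>(y - v))' = \<langle>(l - A v) - (l - A y), y' - v'\<rangle>\<close> and use \<open>\<langle>l - A v, y'\<rangle> \<le> \<psi>(y')\<close> and
  \<open>\<langle>l - A y, v'\<rangle> \<le> \<psi>(v')\<close>: the derivative is at most \<open>\<psi>(v') - \<langle>l - A v, v'\<rangle>\<close>, the integrand of
  \<open>F(v)\<close>, which is infinite otherwise. Integrate over \<open>[0, t]\<close> and bound
  \<open>\<phi>(y0 - v(0)) \<le> \<chi>(v(0) - y0)\<close>.\<close>

section \<open>Measurability of the integrand: lower semicontinuity, conjugate and duality
  pairing\<close>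

lemma lsc_borel_measurable:
  fixes \<psi> :: "'a::metric_space \<Rightarrow> ereal"
  assumes "lower_semicontinuous \<psi>"
  shows "\<psi> \<in> borel_measurable borel"
proof (rule borel_measurableI_greater)
  fix a
  have "open {x. a < \<psi> x}"
  proof (subst open_subopen, intro ballI)
    fix x assume "x \<in> {x. a < \<psi> x}"
    then have ax: "a < \<psi> x" by simp
    then have "a < Liminf (at x) \<psi>"
      using assms unfolding lower_semicontinuous_def by (meson less_le_trans)
    then have "eventually (\<lambda>z. a < \<psi> z) (at x)" by (rule less_LiminfD)
    \<comment> \<open>\<open>Liminf (at x)\<close> sees only the punctured neighbourhood; the value
      at \<open>x\<close> itself comes from \<open>ax\<close>.\<close>
    then have "eventually (\<lambda>z. a < \<psi> z) (nhds x)"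
      using ax by (simp add: eventually_nhds_conv_at)
    then show "\<exists>S. open S \<and> x \<in> S \<and> S \<subseteq> {x. a < \<psi> x}"
      unfolding eventually_nhds by blast
  qed
  then show "{x \<in> space borel. a < \<psi> x} \<in> sets borel" by simp
qed

lemma conjugate_ge: "ereal (blinfun_apply w v) - \<psi> v \<le> conjugate \<psi> w"
  unfolding conjugate_def by (rule SUP_upper) simp

text \<open>On the epigraph \<open>blinfun_apply w v - r\<close> is real and jointly continuous in
  (v, r), whereas \<open>\<psi>\<close> need not be continuous; this is what lets a dense subset
  suffice later. Nonnegativity excludes the value -\<infinity>, so \<open>r = \<psi> v\<close> is a
  real witness.\<close>

lemma less_conjugate_iff_epigraph:
  assumes \<psi>: "\<And>v. 0 \<le> \<psi> v"
  shows "a < conjugate \<psi> w \<longleftrightarrow>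
    (\<exists>v r. \<psi> v \<le> ereal r \<and> a < ereal (blinfun_apply w v - r))"
proof
  assume "a < conjugate \<psi> w"
  then obtain v where v: "a < ereal (blinfun_apply w v) - \<psi> v"
    unfolding conjugate_def less_SUP_iff by blast
  then obtain r where "\<psi> v = ereal r" using \<psi>[of v] by (cases "\<psi> v") auto
  with v show "\<exists>v r. \<psi> v \<le> ereal r \<and> a < ereal (blinfun_apply w v - r)"
    by (intro exI[of _ v] exI[of _ r]) auto
next
  assume "\<exists>v r. \<psi> v \<le> ereal r \<and> a < ereal (blinfun_apply w v - r)"
  then obtain v r where vr: "\<psi> v \<le> ereal r" "a < ereal (blinfun_apply w v - r)" by blast
  have "a < ereal (blinfun_apply w v - r)" by (rule vr)
  also have "\<dots> \<le> ereal (blinfun_apply w v) - \<psi> v"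
    using vr \<psi>[of v] by (cases "\<psi> v") auto
  also have "\<dots> \<le> conjugate \<psi> w" by (rule conjugate_ge)
  finally show "a < conjugate \<psi> w" .
qed

text \<open>The supremum over \<open>v\<close> is reduced to a countable dense subset of the epigraph of \<open>\<psi>\<close>; this
  needs only the weak measurability of \<open>w\<close>, so that separability of the dual plays no role.\<close>

lemma conjugate_borel_measurable:
  fixes \<psi> :: "'a::{real_normed_vector, second_countable_topology} \<Rightarrow> ereal"
  assumes \<psi>: "\<And>v. 0 \<le> \<psi> v"
    and w: "\<And>v. (\<lambda>t. blinfun_apply (w t) v) \<in> borel_measurable M"
  shows "(\<lambda>t. conjugate \<psi> (w t)) \<in> borel_measurable M"
proof -
  let ?E = "{(v, r). \<psi> v \<le> ereal r}"
  obtain D where D: "countable D" "D \<subseteq> ?E" "?E \<subseteq> closure D"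
    using separable[of ?E] by metis
  have iff: "a < conjugate \<psi> (w t) \<longleftrightarrow>
      (\<exists>p\<in>D. a < ereal (blinfun_apply (w t) (fst p) - snd p))" for a t
  proof
    assume "a < conjugate \<psi> (w t)"
    then obtain v r where vr: "(v, r) \<in> ?E" "a < ereal (blinfun_apply (w t) v - r)"
      using less_conjugate_iff_epigraph[of \<psi>, OF \<psi>] by blast
    let ?U = "{p. a < ereal (blinfun_apply (w t) (fst p) - snd p)}"
    \<comment> \<open>An open set that meets the closure of \<open>D\<close> meets \<open>D\<close>
      itself, which moves the witness into the countable set.\<close>
    have "open ?U" by (intro open_Collect_less continuous_intros)
    moreover have "(v, r) \<in> ?U \<inter> closure D" using vr D(3) by auto
    ultimately show "\<exists>p\<in>D. a < ereal (blinfun_apply (w t) (fst p) - snd p)"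
      using open_Int_closure_eq_empty[of ?U D] by blast
  next
    assume "\<exists>p\<in>D. a < ereal (blinfun_apply (w t) (fst p) - snd p)"
    then show "a < conjugate \<psi> (w t)"
      using D(2) less_conjugate_iff_epigraph[of \<psi>, OF \<psi>] by fastforce
  qed
  have "{t \<in> space M. a < conjugate \<psi> (w t)} \<in> sets M" for a
  proof -
    have "{t \<in> space M. a < conjugate \<psi> (w t)} =
        (\<Union>p\<in>D. {t \<in> space M. a < ereal (blinfun_apply (w t) (fst p) - snd p)})"
      using iff by auto
    moreover have "{t \<in> space M. a < ereal (blinfun_apply (w t) (fst p) - snd p)} \<in> sets M" for p
      using w[of "fst p", measurable] by measurable
    ultimately show ?thesis using D(1) by (auto intro: sets.countable_UN')
  qed
  then show ?thesis by (rule borel_measurableI_greater)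
qed

text \<open>Measurability of \<open>w\<close> is known only after evaluation at fixed vectors. For
  finitely valued \<open>g\<close> the pairing glues finitely many such functions; the general case
  is a pointwise limit of these, since each \<open>w t\<close> is continuous.\<close>

lemma blinfun_apply_borel_measurable:
  fixes g :: "'b \<Rightarrow> 'a::{real_normed_vector, second_countable_topology}"
    and w :: "'b \<Rightarrow> 'a \<Rightarrow>\<^sub>L real"
  assumes w: "\<And>v. (\<lambda>t. blinfun_apply (w t) v) \<in> borel_measurable M"
    and g: "g \<in> borel_measurable M"
  shows "(\<lambda>t. blinfun_apply (w t) (g t)) \<in> borel_measurable M"
proof -
  obtain S where S: "\<And>i. simple_function M (S i)"
      "\<And>t. t \<in> space M \<Longrightarrow> (\<lambda>i. S i t) \<longlonglongrightarrow> g t"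
    using borel_measurable_implies_sequence_metric[OF g, of 0] by blast
  have "(\<lambda>t. blinfun_apply (w t) (S i t)) \<in> borel_measurable M" for i
  proof (rule measurable_compose_countable'[where f = "\<lambda>v t. blinfun_apply (w t) v" and g = "S i"
        and I = "S i ` space M"])
    show "countable (S i ` space M)"
      using S(1)[of i] by (auto dest: simple_functionD(1) intro: countable_finite)
    show "S i \<in> measurable M (count_space (S i ` space M))"
      using simple_functionD[OF S(1)[of i]] by (subst measurable_count_space_eq2) auto
  qed (rule w)
  then show ?thesis
    by (rule borel_measurable_LIMSEQ_metric) (auto intro!: tendsto_intros S(2))
qed

section \<open>The conjugate of a positively homogeneous function\<close>

text \<open>Replacing \<open>v\<close> by \<open>c *\<^sub>R v\<close> multiplies
  \<open>blinfun_apply w v - \<psi> v\<close> by \<open>c\<close>. A finite supremum therefore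
  excludes positive values (large \<open>c\<close>) and cannot be negative (small \<open>c\<close>).
  So the conjugate is an indicator function, and the second conclusion is membership of
  \<open>w\<close> in \<open>C\<^sup>*\<close>.\<close>

lemma conjugate_pos_homogeneous:
  assumes \<psi>: "\<And>v. 0 \<le> \<psi> v" and "proper \<psi>" and hom: "pos_homogeneous \<psi>"
    and fin: "conjugate \<psi> w \<noteq> \<infinity>"
  shows "conjugate \<psi> w = 0" and "ereal (blinfun_apply w v) \<le> \<psi> v"
proof -
  have scale: "ereal c * (ereal (blinfun_apply w v) - \<psi> v) \<le> conjugate \<psi> w" if "c > 0" for c v
  proof -
    have "ereal (blinfun_apply w (c *\<^sub>R v)) - \<psi> (c *\<^sub>R v) \<le> conjugate \<psi> w"
      by (rule conjugate_ge)
    then show ?thesis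
      using hom that \<psi>[of v] unfolding pos_homogeneous_def
      by (cases "\<psi> v") (auto simp: blinfun.scaleR_right right_diff_distrib)
  qed
  \<comment> \<open>Homogeneity for c > 0 leaves open whether \<open>\<psi> 0\<close> is 0 or
    infinite, so the lower bound is taken from a point of the domain that is shrunk towards
    0.\<close>
  obtain v0 r0 where v0: "\<psi> v0 = ereal r0"
  proof -
    obtain v0 where "\<psi> v0 < \<infinity>" using \<open>proper \<psi>\<close> unfolding proper_def eff_dom_def by blast
    then show thesis using that \<psi>[of v0] by (cases "\<psi> v0") auto
  qed
  obtain k where k: "conjugate \<psi> w = ereal k"
    using fin scale[of 1 v0] v0 by (cases "conjugate \<psi> w") auto
  have le: "blinfun_apply w v \<le> r" if r: "\<psi> v = ereal r" for v r
  proof (rule ccontr)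
    assume "\<not> blinfun_apply w v \<le> r"
    then have pos: "blinfun_apply w v - r > 0" by simp
    \<comment> \<open>The factor makes the scaled difference equal to
      \<open>\<bar>k\<bar> + 1\<close>, which exceeds the supremum \<open>k\<close>.\<close>
    then have "((\<bar>k\<bar> + 1) / (blinfun_apply w v - r)) * (blinfun_apply w v - r) \<le> k"
      using scale[of "(\<bar>k\<bar> + 1) / (blinfun_apply w v - r)" v] r k by auto
    then show False using pos by simp
  qed
  show bound: "ereal (blinfun_apply w v) \<le> \<psi> v" for v
    using le[of v] \<psi>[of v] by (cases "\<psi> v") auto
  have "ereal (blinfun_apply w v) - \<psi> v \<le> 0" for v
    using bound[of v] by (cases "\<psi> v") auto
  then have "conjugate \<psi> w \<le> 0"
    unfolding conjugate_def by (intro SUP_least)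
  moreover have "0 \<le> k"
  proof (rule field_le_epsilon)
    fix e :: real assume "e > 0"
    \<comment> \<open>The summand 1 keeps \<open>d\<close> positive, and \<open>d\<close> dominates
      the difference at \<open>v0\<close>, so scaling by \<open>e / d\<close> costs at most
      \<open>e\<close>.\<close>
    define d where "d = \<bar>blinfun_apply w v0 - r0\<bar> + 1"
    have "(e / d) * (blinfun_apply w v0 - r0) \<le> k"
      using scale[of "e / d" v0] \<open>e > 0\<close> v0 k by (auto simp: d_def)
    moreover have "(e / d) * (- d) \<le> (e / d) * (blinfun_apply w v0 - r0)"
      using \<open>e > 0\<close> by (intro mult_left_mono) (auto simp: d_def)
    moreover have "(e / d) * (- d) = - e"
      using abs_ge_zero[of "blinfun_apply w v0 - r0"] unfolding d_def by (auto simp: field_simps)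
    ultimately show "0 \<le> k + e" by linarith
  qed
  ultimately show "conjugate \<psi> w = 0" using k by auto
qed

section \<open>Primitives of Bochner integrable functions: bilinear forms and continuity\<close>

lemma lebesgue_on_restrict:
  assumes "t \<le> T"
  shows "lebesgue_on {0..t} = restrict_space (lebesgue_on {0..T}) {0..t::real}"
  using assms by (subst restrict_restrict_space) (auto simp: Int_absorb1)

text \<open>Boundedness of \<open>B\<close> dominates the kernel by a constant times
  \<open>norm (g r) * norm (g s)\<close>, a product of integrable functions of separate
  variables.\<close>

lemma integrable_bilinear_pair:
  fixes B :: "'a::{banach, second_countable_topology} \<Rightarrow> 'a \<Rightarrow> real"
  assumes "bounded_bilinear B" and fin: "finite_measure M" and g: "integrable M g"
  shows "integrable (M \<Otimes>\<^sub>M M) (\<lambda>(r, s). B (g r) (g s))"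
proof -
  interpret B: bounded_bilinear B by fact
  interpret M: finite_measure M by fact
  interpret P: pair_sigma_finite M M ..
  obtain K where K: "\<And>x y. norm (B x y) \<le> norm x * norm y * K" using B.bounded by blast
  have gm[measurable]: "g \<in> borel_measurable M" using g by auto
  have bil: "(\<lambda>p. B (g (fst p)) (g (snd p))) \<in> borel_measurable (M \<Otimes>\<^sub>M M)"
    by (rule borel_measurable_continuous_Pair) (auto intro!: continuous_intros B.continuous_on)
  have dom: "integrable (M \<Otimes>\<^sub>M M) (\<lambda>p. norm (g (fst p)) * norm (g (snd p)) * K)"
    by (rule P.Fubini_integrable) (use g in \<open>auto simp: abs_mult\<close>)
  show ?thesis
    unfolding case_prod_beta'
    by (rule Bochner_Integration.integrable_bound[OF dom bil]) (use K in \<open>force intro: order_trans[OF _ abs_ge_self]\<close>)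
qed

text \<open>Serves to discard the diagonal of a square and the limit of a moving endpoint of
  integration.\<close>

lemma AE_lebesgue_on_neq: "AE r in lebesgue_on {0..t::real}. r \<noteq> s"
proof -
  have "AE r in lebesgue. r \<noteq> s"
    by (rule AE_completion) (rule AE_lborel_singleton)
  then have "AE r in lebesgue. r \<in> {0..t} \<longrightarrow> r \<noteq> s"
    by eventually_elim simp
  then show ?thesis by (simp add: AE_restrict_space_iff)
qed

text \<open>The symmetric kernel \<open>B (g r) (g s)\<close> has the same integral over the triangles \<open>r \<le> s\<close> and
  \<open>s \<le> r\<close>, which replaces the differentiation of a vector-valued absolutely continuous function.\<close>

lemma integral_bilinear_primitive:
  fixes B :: "'a::{banach, second_countable_topology} \<Rightarrow> 'a \<Rightarrow> real"
  assumes B: "bounded_bilinear B" and sym: "\<And>x y. B x y = B y x"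
    and g: "integrable (lebesgue_on {0..t::real}) g"
  defines "G \<equiv> \<lambda>s. \<integral>r. g r \<partial>lebesgue_on {0..s}"
  shows "integrable (lebesgue_on {0..t}) (\<lambda>s. B (G s) (g s))"
    and "(\<integral>s. B (G s) (g s) \<partial>lebesgue_on {0..t}) = B (G t) (G t) / 2"
proof -
  interpret B: bounded_bilinear B by fact
  define M where "M = lebesgue_on {0..t}"
  have fin: "finite_measure M" unfolding M_def by (metis cbox_interval finite_measure_lebesgue_on lmeasurable_cbox)
  interpret M: finite_measure M by fact
  interpret P: pair_sigma_finite M M ..
  have g: "integrable M g" using g by (simp add: M_def)
  have [measurable]: "(\<lambda>x. x) \<in> borel_measurable M"
    unfolding M_def by (intro measurable_restrict_space1 measurable_completion) simp
  \<comment> \<open>The kernel cut off to the triangle r \<le> s.\<close>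
  define h where "h = (\<lambda>r s. indicator {r..} s *\<^sub>R B (g r) (g s))"
  have hint: "integrable (M \<Otimes>\<^sub>M M) (\<lambda>(r, s). h r s)"
  proof -
    have "{p \<in> space (M \<Otimes>\<^sub>M M). fst p \<le> snd p} \<in> sets (M \<Otimes>\<^sub>M M)" by measurable
    from integrable_mult_indicator[OF this integrable_bilinear_pair[OF B fin g]]
    show ?thesis
      by (rule Bochner_Integration.integrable_cong[THEN iffD1, OF refl, rotated])
        (auto simp: h_def indicator_def)
  qed
  \<comment> \<open>At fixed \<open>s\<close> the cutoff confines \<open>r\<close> to [0, s], where
    \<open>g\<close> integrates to \<open>G s\<close>.\<close>
  have inner: "(\<integral>r. h r s \<partial>M) = B (G s) (g s)" if "s \<in> space M" for s
  proof -
    have s: "s \<le> t" using that by (simp add: M_def)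
    have "(\<integral>r. h r s \<partial>M) = (\<integral>r. B (indicator {0..s} r *\<^sub>R g r) (g s) \<partial>M)"
      by (rule Bochner_Integration.integral_cong) (auto simp: h_def M_def indicator_def B.zero_left)
    also have "\<dots> = B (\<integral>r. indicator {0..s} r *\<^sub>R g r \<partial>M) (g s)"
      by (rule integral_bounded_linear[OF B.bounded_linear_left])
        (use s in \<open>auto intro!: integrable_mult_indicator g[unfolded M_def] simp: M_def sets_restrict_space_iff\<close>)
    also have "(\<integral>r. indicator {0..s} r *\<^sub>R g r \<partial>M) = G s"
      unfolding G_def M_def lebesgue_on_restrict[OF s]
      by (subst integral_restrict_space) (auto simp: sets_restrict_space_iff s)
    finally show ?thesis .
  qed
  have "integrable M (\<lambda>s. \<integral>r. h r s \<partial>M)" using P.integrable_snd[OF hint] .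
  then have int: "integrable M (\<lambda>s. B (G s) (g s))"
    by (rule Bochner_Integration.integrable_cong[THEN iffD1, OF refl, rotated]) (simp add: inner)
  then show "integrable (lebesgue_on {0..t}) (\<lambda>s. B (G s) (g s))" by (simp add: M_def)
  let ?I = "\<integral>s. B (G s) (g s) \<partial>M"
  have I1: "?I = (\<integral>s. (\<integral>r. h r s \<partial>M) \<partial>M)"
    by (rule Bochner_Integration.integral_cong) (simp_all add: inner)
  \<comment> \<open>Fubini followed by exchanging the names of the variables: the same integral, now
    over the reflected triangle.\<close>
  also have I2: "\<dots> = (\<integral>s. (\<integral>r. h s r \<partial>M) \<partial>M)"
    by (rule P.Fubini_integral[OF hint])
  finally have I3: "?I = (\<integral>s. (\<integral>r. h s r \<partial>M) \<partial>M)" .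
  \<comment> \<open>The two triangles tile the square up to the diagonal, and over the square the
    kernel integrates to \<open>B (G t) (G t)\<close>; hence the factor 1/2.\<close>
  have "2 * ?I = (\<integral>s. (\<integral>r. h r s \<partial>M) \<partial>M) + (\<integral>s. (\<integral>r. h s r \<partial>M) \<partial>M)"
    using I1 I3 by simp
  also have "\<dots> = (\<integral>s. (\<integral>r. h r s \<partial>M) + (\<integral>r. h s r \<partial>M) \<partial>M)"
    by (rule Bochner_Integration.integral_add[symmetric])
      (use P.integrable_snd[OF hint] P.integrable_fst[OF hint] in auto)
  also have "\<dots> = (\<integral>s. B (G t) (g s) \<partial>M)"
  proof (rule integral_cong_AE)
    have ae1: "AE s in M. integrable M (\<lambda>r. h r s)"
      using P.AE_integrable_snd[OF hint] .
    have ae2: "AE s in M. integrable M (\<lambda>r. h s r)"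
      using P.AE_integrable_fst[OF hint] .
    show "AE s in M. (\<integral>r. h r s \<partial>M) + (\<integral>r. h s r \<partial>M) = B (G t) (g s)"
      using ae1 ae2
    proof eventually_elim
      case (elim s)
      have "(\<integral>r. h r s \<partial>M) + (\<integral>r. h s r \<partial>M) = (\<integral>r. h r s + h s r \<partial>M)"
        by (rule Bochner_Integration.integral_add[symmetric]) (use elim in auto)
      also have "\<dots> = (\<integral>r. B (g r) (g s) \<partial>M)"
      proof (rule integral_cong_AE)
        \<comment> \<open>By symmetry of \<open>B\<close> the sum is the full kernel off the
          diagonal; on the diagonal it is counted twice.\<close>
        have "AE r in M. r \<noteq> s" unfolding M_def by (rule AE_lebesgue_on_neq)
        then show "AE r in M. h r s + h s r = B (g r) (g s)"
          by eventually_elim (auto simp: h_def indicator_def sym)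
        show "(\<lambda>r. h r s + h s r) \<in> borel_measurable M" using elim by auto
        show "(\<lambda>r. B (g r) (g s)) \<in> borel_measurable M"
          using integrable_bounded_linear[OF B.bounded_linear_left g] by auto
      qed
      also have "\<dots> = B (G t) (g s)"
        unfolding G_def M_def[symmetric] by (rule integral_bounded_linear[OF B.bounded_linear_left g])
      finally show ?case .
    qed
  next
    show "(\<lambda>s. (\<integral>r. h r s \<partial>M) + (\<integral>r. h s r \<partial>M)) \<in> borel_measurable M"
      using P.integrable_snd[OF hint] P.integrable_fst[OF hint] by auto
    show "(\<lambda>s. B (G t) (g s)) \<in> borel_measurable M"
      using integrable_bounded_linear[OF B.bounded_linear_right g] by auto
  qed
  also have "\<dots> = B (G t) (G t)"
    unfolding G_def M_def[symmetric] by (rule integral_bounded_linear[OF B.bounded_linear_right g])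
  finally show "(\<integral>s. B (G s) (g s) \<partial>lebesgue_on {0..t}) = B (G t) (G t) / 2"
    by (simp add: M_def)
qed

lemma integrable_lebesgue_on_subinterval:
  fixes g :: "real \<Rightarrow> 'a::{banach, second_countable_topology}"
  assumes "integrable (lebesgue_on {0..T}) g" "t \<le> T"
  shows "integrable (lebesgue_on {0..t}) g"
proof -
  have "{0..t} \<inter> {0..T} \<in> sets (lebesgue_on {0..T})" by (auto simp: sets_restrict_space_iff)
  then have "integrable (lebesgue_on {0..T}) (\<lambda>s. indicator ({0..t} \<inter> {0..T}) s *\<^sub>R g s)"
    using assms(1) by (rule integrable_mult_indicator)
  then have "integrable (lebesgue_on {0..T}) (\<lambda>s. indicator {0..t} s *\<^sub>R g s)"
    by (rule Bochner_Integration.integrable_cong[THEN iffD1, OF refl, rotated]) (simp add: indicator_def)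
  then show ?thesis
    unfolding lebesgue_on_restrict[OF assms(2)]
    by (subst integrable_restrict_space) (auto simp: sets_restrict_space_iff)
qed

text \<open>The moving endpoint becomes an indicator under one fixed measure, so dominated
  convergence applies with majorant \<open>norm (g s)\<close>. The indicators converge at every
  point other than the limiting endpoint.\<close>

lemma continuous_on_primitive:
  fixes g :: "real \<Rightarrow> 'a::{banach, second_countable_topology}"
  assumes g: "integrable (lebesgue_on {0..T}) g"
  shows "continuous_on {0..T} (\<lambda>t. \<integral>s. g s \<partial>lebesgue_on {0..t})"
proof -
  let ?M = "lebesgue_on {0..T}"
  have sets: "{0..t} \<inter> {0..T} \<in> sets ?M" for t
    by (auto simp: sets_restrict_space_iff)
  have "continuous_on {0..T} (\<lambda>t. \<integral>s. indicator {0..t} s *\<^sub>R g s \<partial>?M)"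
  proof (rule continuous_on_sequentiallyI)
    fix u :: "nat \<Rightarrow> real" and a
    assume u: "\<forall>n. u n \<in> {0..T}" "a \<in> {0..T}" "u \<longlonglongrightarrow> a"
    have meas: "(\<lambda>s. indicator {0..t} s *\<^sub>R g s) \<in> borel_measurable ?M" if "t \<in> {0..T}" for t
    proof -
      have "{0..t} \<in> sets ?M" using that by (auto simp: sets_restrict_space_iff)
      from integrable_mult_indicator[OF this g] show ?thesis by auto
    qed
    show "(\<lambda>n. \<integral>s. indicator {0..u n} s *\<^sub>R g s \<partial>?M) \<longlonglongrightarrow> (\<integral>s. indicator {0..a} s *\<^sub>R g s \<partial>?M)"
    proof (rule integral_dominated_convergence[where w = "\<lambda>s. norm (g s)"])
      have "AE s in ?M. s \<noteq> a" by (rule AE_lebesgue_on_neq)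
      then show "AE s in ?M. (\<lambda>n. indicator {0..u n} s *\<^sub>R g s) \<longlonglongrightarrow> indicator {0..a} s *\<^sub>R g s"
      proof eventually_elim
        case (elim s)
        have "eventually (\<lambda>n. (s \<le> u n) = (s \<le> a)) sequentially"
        proof (cases "s < a")
          case True
          from order_tendstoD(1)[OF u(3) this] show ?thesis
            by eventually_elim (use True in auto)
        next
          case False
          with elim have "a < s" by simp
          from order_tendstoD(2)[OF u(3) this] show ?thesis
            by eventually_elim (use \<open>a < s\<close> in auto)
        qed
        then have "eventually (\<lambda>n. indicator {0..u n} s *\<^sub>R g s = indicator {0..a} s *\<^sub>R g s) sequentially"
          by eventually_elim (auto simp: indicator_def)
        then show ?case by (rule tendsto_eventually)
      qed
      show "AE s in ?M. norm (indicator {0..u n} s *\<^sub>R g s) \<le> norm (g s)" for n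
        by (auto simp: indicator_def)
    qed (use u g meas in auto)
  qed
  then show ?thesis
  proof (rule continuous_on_eq)
    fix t assume "t \<in> {0..T}"
    then have t: "t \<le> T" by simp
    show "(\<integral>s. indicator {0..t} s *\<^sub>R g s \<partial>?M) = (\<integral>s. g s \<partial>lebesgue_on {0..t})"
      unfolding lebesgue_on_restrict[OF t]
      by (subst integral_restrict_space) (use sets[of t] in auto)
  qed
qed

section \<open>Calculus in \<open>W11\<close>: differences, continuity and the chain rule for the
  energy\<close>

lemma W11_deriv_spec: "u \<in> W11 T \<Longrightarrow> is_W11_deriv T u (W11_deriv T u)"
proof -
  assume "u \<in> W11 T"
  then obtain g where "is_W11_deriv T u g" unfolding W11_def by blast
  then show ?thesis unfolding W11_deriv_def by (rule someI[of "is_W11_deriv T u"])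
qed

lemma is_W11_derivD:
  assumes "is_W11_deriv T u g"
  shows "integrable (lebesgue_on {0..T}) g"
    and "t \<in> {0..T} \<Longrightarrow> u t = u 0 + (\<integral>s. g s \<partial>lebesgue_on {0..t})"
proof -
  have *: "integrable (lebesgue_on {0..T}) g \<and>
      (\<forall>t\<in>{0..T}. u t = u 0 + (\<integral>s. g s \<partial>lebesgue_on {0..t}))"
    using assms unfolding is_W11_deriv_def .
  show "integrable (lebesgue_on {0..T}) g" by (rule conjunct1[OF *])
  show "u t = u 0 + (\<integral>s. g s \<partial>lebesgue_on {0..t})" if "t \<in> {0..T}"
    by (rule bspec[OF conjunct2[OF *] that])
qed

lemma is_W11_deriv_diff:
  assumes "is_W11_deriv T u g" "is_W11_deriv T v h"
  shows "is_W11_deriv T (\<lambda>t. u t - v t) (\<lambda>t. g t - h t)"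
proof -
  have "u t - v t = u 0 - v 0 + (\<integral>s. g s - h s \<partial>lebesgue_on {0..t})" if t: "t \<in> {0..T}" for t
  proof -
    have "u t = u 0 + (\<integral>s. g s \<partial>lebesgue_on {0..t})" "v t = v 0 + (\<integral>s. h s \<partial>lebesgue_on {0..t})"
      using is_W11_derivD(2)[OF assms(1) t] is_W11_derivD(2)[OF assms(2) t] .
    moreover have "(\<integral>s. g s - h s \<partial>lebesgue_on {0..t}) =
        (\<integral>s. g s \<partial>lebesgue_on {0..t}) - (\<integral>s. h s \<partial>lebesgue_on {0..t})"
      using assms t
      by (intro Bochner_Integration.integral_diff integrable_lebesgue_on_subinterval[OF is_W11_derivD(1)]) auto
    ultimately show ?thesis by simp
  qed
  moreover have "integrable (lebesgue_on {0..T}) (\<lambda>t. g t - h t)"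
    using assms by (intro Bochner_Integration.integrable_diff is_W11_derivD(1))
  ultimately show ?thesis unfolding is_W11_deriv_def by (intro conjI ballI)
qed

lemma is_W11_deriv_continuous_on:
  assumes "is_W11_deriv T u g"
  shows "continuous_on {0..T} u"
proof -
  have "continuous_on {0..T} (\<lambda>t. u 0 + (\<integral>s. g s \<partial>lebesgue_on {0..t}))"
    by (intro continuous_intros continuous_on_primitive is_W11_derivD(1)[OF assms])
  then show ?thesis
    by (rule continuous_on_eq) (rule is_W11_derivD(2)[OF assms, symmetric])
qed

text \<open>Split \<open>u\<close> into \<open>u 0\<close> and the primitive \<open>G\<close>. The
  constant part pairs linearly with \<open>g\<close> and gives \<open>B (u 0) (G t)\<close>; the
  primitive gives \<open>B (G t) (G t) / 2\<close>. Symmetry identifies the two cross terms in the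
  expansion of \<open>energy A (u 0 + G t)\<close>.\<close>

lemma energy_chain_rule:
  assumes sym: "symmetric_op A" and u: "is_W11_deriv T u g" and t: "t \<in> {0..T}"
  shows "integrable (lebesgue_on {0..t}) (\<lambda>s. blinfun_apply (blinfun_apply A (u s)) (g s))"
    and "energy A (u t) = energy A (u 0) +
      (\<integral>s. blinfun_apply (blinfun_apply A (u s)) (g s) \<partial>lebesgue_on {0..t})"
proof -
  define B where "B = (\<lambda>x z. blinfun_apply (blinfun_apply A x) z)"
  interpret B: bounded_bilinear B
    unfolding B_def
    by (rule bounded_bilinear.comp1[OF bounded_bilinear_blinfun_apply blinfun.bounded_linear_right])
  have symB: "B x z = B z x" for x z using sym by (simp add: B_def symmetric_op_def)
  define G where "G = (\<lambda>s. \<integral>r. g r \<partial>lebesgue_on {0..s})"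
  have g: "integrable (lebesgue_on {0..t}) g"
    using is_W11_derivD(1)[OF u] by (rule integrable_lebesgue_on_subinterval) (use t in simp)
  have uG: "u s = u 0 + G s" if "s \<in> {0..T}" for s
    unfolding G_def by (rule is_W11_derivD(2)[OF u that])
  have prim: "integrable (lebesgue_on {0..t}) (\<lambda>s. B (G s) (g s))"
      "(\<integral>s. B (G s) (g s) \<partial>lebesgue_on {0..t}) = B (G t) (G t) / 2"
    unfolding G_def
    by (rule integral_bilinear_primitive[OF B.bounded_bilinear_axioms symB g])+
  have lin: "integrable (lebesgue_on {0..t}) (\<lambda>s. B (u 0) (g s))"
    by (rule integrable_bounded_linear[OF B.bounded_linear_right g])
  have eq: "B (u s) (g s) = B (u 0) (g s) + B (G s) (g s)" if "s \<in> {0..t}" for s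
    using uG[of s] that t by (simp add: B.add_left)
  have "integrable (lebesgue_on {0..t}) (\<lambda>s. B (u 0) (g s) + B (G s) (g s))"
    using lin prim(1) by (rule Bochner_Integration.integrable_add)
  then have "integrable (lebesgue_on {0..t}) (\<lambda>s. B (u s) (g s))"
    by (rule Bochner_Integration.integrable_cong[THEN iffD1, OF refl, rotated]) (simp add: eq)
  then show "integrable (lebesgue_on {0..t}) (\<lambda>s. blinfun_apply (blinfun_apply A (u s)) (g s))"
    by (simp add: B_def)
  have "(\<integral>s. B (u s) (g s) \<partial>lebesgue_on {0..t}) =
      (\<integral>s. B (u 0) (g s) + B (G s) (g s) \<partial>lebesgue_on {0..t})"
    by (rule Bochner_Integration.integral_cong) (simp_all add: eq)
  also have "\<dots> = B (u 0) (G t) + B (G t) (G t) / 2"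
    using integral_bounded_linear[OF B.bounded_linear_right g, of "u 0"] lin prim
    by (simp add: G_def)
  finally have "(\<integral>s. B (u s) (g s) \<partial>lebesgue_on {0..t}) = B (u 0) (G t) + B (G t) (G t) / 2" .
  then show "energy A (u t) = energy A (u 0) +
      (\<integral>s. blinfun_apply (blinfun_apply A (u s)) (g s) \<partial>lebesgue_on {0..t})"
    using uG[OF t] symB[of "G t" "u 0"]
    by (simp add: energy_def B_def blinfun.add_left blinfun.add_right field_simps)
qed

section \<open>Pointwise inequalities for the integrand\<close>

text \<open>The integrand of \<open>BE_functional\<close> with time frozen, before truncation by
  \<open>e2ennreal\<close>: \<open>w\<close> stands for the force \<open>l - A y\<close> and
  \<open>x\<close> for the velocity.\<close>

definition BE_integrand ::
  "('a::real_normed_vector \<Rightarrow> ereal) \<Rightarrow> ('a \<Rightarrow>\<^sub>L real) \<Rightarrow> 'a \<Rightarrow> ereal" where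
  "BE_integrand \<psi> w x = \<psi> x + conjugate \<psi> w - ereal (blinfun_apply w x)"

text \<open>Finiteness puts \<open>w\<close> in \<open>C\<^sup>*\<close>, so Fenchel-Young holds and
  must be an equality. The hypothesis is \<le> 0 because \<open>e2ennreal\<close> vanishes on all
  nonpositive values.\<close>

lemma BE_integrand_le_0:
  assumes \<psi>: "\<And>v. 0 \<le> \<psi> v" "proper \<psi>" "pos_homogeneous \<psi>"
    and le: "BE_integrand \<psi> w x \<le> 0"
  shows "conjugate \<psi> w = 0" "\<psi> x = ereal (blinfun_apply w x)"
proof -
  have "conjugate \<psi> w \<noteq> \<infinity>" "\<psi> x \<noteq> \<infinity>"
    using le \<psi>(1)[of x] unfolding BE_integrand_def by (auto simp: ereal_minus_eq_PInfty_iff)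
  note * = conjugate_pos_homogeneous[OF \<psi> this(1)] this(2)
  show "conjugate \<psi> w = 0" by (rule *)
  then show "\<psi> x = ereal (blinfun_apply w x)"
    using le *(2)[of x] *(3) \<psi>(1)[of x] unfolding BE_integrand_def by (cases "\<psi> x") auto
qed

text \<open>With \<open>w = l - A y\<close>, \<open>x = y'\<close> for the solution and \<open>w' = l - A v\<close>, \<open>x' = v'\<close> for the
  competitor, the left-hand side is the derivative of \<open>energy A (y - v)\<close>.\<close>

lemma BE_integrand_ge:
  assumes \<psi>: "\<And>v. 0 \<le> \<psi> v" "proper \<psi>" "pos_homogeneous \<psi>"
    and le: "BE_integrand \<psi> w x \<le> 0"
  shows "ereal (blinfun_apply (w' - w) (x - x')) \<le> BE_integrand \<psi> w' x'"
proof (cases "conjugate \<psi> w' = \<infinity> \<or> \<psi> x' = \<infinity>")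
  case True
  \<comment> \<open>A conjugate that is not \<infinity> equals 0, so -\<infinity> is impossible and
    the right-hand side of the claim is infinite.\<close>
  have "conjugate \<psi> w' \<noteq> -\<infinity>"
    using conjugate_pos_homogeneous(1)[OF \<psi>, of w'] by auto
  with True show ?thesis using \<psi>(1)[of x'] unfolding BE_integrand_def by auto
next
  case False
  note w = BE_integrand_le_0[OF \<psi> le]
  have fin: "conjugate \<psi> w \<noteq> \<infinity>" using w by simp
  have fin': "conjugate \<psi> w' \<noteq> \<infinity>" using False by simp
  \<comment> \<open>Of the four pairings in the expansion, \<open>w' x - w x\<close> is at most 0
    because \<open>w x\<close> equals \<open>\<psi> x\<close>, and \<open>w x'\<close> is at most
    \<open>\<psi> x'\<close>.\<close>
  have "ereal (blinfun_apply w' x) \<le> \<psi> x" "ereal (blinfun_apply w x') \<le> \<psi> x'" "conjugate \<psi> w' = 0"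
    using conjugate_pos_homogeneous[OF \<psi> fin'] conjugate_pos_homogeneous[OF \<psi> fin] by auto
  then show ?thesis
    using w(2) False \<psi>(1)[of x'] unfolding BE_integrand_def
    by (cases "\<psi> x'") (auto simp: blinfun.diff_left blinfun.diff_right)
qed

section \<open>From a vanishing functional to the energy estimate\<close>

text \<open>Both summands are nonnegative, so both vanish. Definiteness of \<open>chi\<close> fixes
  the initial value; measurability of the integrand turns the vanishing integral into an almost
  everywhere statement.\<close>

lemma BE_functional_eq_0:
  fixes \<psi> :: "'a::{banach, second_countable_topology} \<Rightarrow> ereal"
  assumes \<psi>: "\<And>v. 0 \<le> \<psi> v" "lower_semicontinuous \<psi>"
    and chi: "\<And>x. chi A x \<ge> 0" "\<And>x. chi A x = 0 \<longleftrightarrow> x = 0"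
    and l: "l \<in> Linf T" and y: "y \<in> W11 T"
    and zero: "BE_functional T \<psi> A l y0 y = 0"
  shows "y 0 = y0"
    and "AE t in lebesgue_on {0..T}. BE_integrand \<psi> (l t - blinfun_apply A (y t)) (W11_deriv T y t) \<le> 0"
proof -
  let ?M = "lebesgue_on {0..T}"
  let ?w = "\<lambda>t. l t - blinfun_apply A (y t)"
  let ?g = "W11_deriv T y"
  let ?f = "\<lambda>t. BE_integrand \<psi> (?w t) (?g t)"
  have "0 \<le> enn2ereal (\<integral>\<^sup>+t. e2ennreal (?f t) \<partial>?M)" "0 \<le> ereal (chi A (y 0 - y0))"
    using chi(1) by auto
  moreover have "enn2ereal (\<integral>\<^sup>+t. e2ennreal (?f t) \<partial>?M) + ereal (chi A (y 0 - y0)) = 0"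
    using zero unfolding BE_functional_def BE_integrand_def .
  ultimately have "enn2ereal (\<integral>\<^sup>+t. e2ennreal (?f t) \<partial>?M) = 0" "ereal (chi A (y 0 - y0)) = 0"
    using add_nonneg_eq_0_iff by blast+
  then have int0: "(\<integral>\<^sup>+t. e2ennreal (?f t) \<partial>?M) = 0" and "chi A (y 0 - y0) = 0"
    by (metis enn2ereal_inject zero_ennreal.rep_eq, simp)
  then show "y 0 = y0" using chi(2) by simp
  have "is_W11_deriv T y ?g" using y by (rule W11_deriv_spec)
  then have g: "?g \<in> borel_measurable ?M" and cont: "continuous_on {0..T} y"
    using is_W11_derivD(1) is_W11_deriv_continuous_on borel_measurable_integrable by blast+
  \<comment> \<open>Weak measurability of the force: \<open>l\<close> is measurable by
    \<open>Linf\<close>, and \<open>A y\<close> is continuous in time.\<close>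
  have w: "(\<lambda>t. blinfun_apply (?w t) v) \<in> borel_measurable ?M" for v
  proof -
    have "l \<in> borel_measurable ?M" using l by (simp add: Linf_def)
    then have "(\<lambda>t. blinfun_apply (l t) v) \<in> borel_measurable ?M"
      by (rule borel_measurable_continuous_on[rotated]) (intro continuous_intros)
    moreover have "(\<lambda>t. blinfun_apply (blinfun_apply A (y t)) v) \<in> borel_measurable ?M"
      by (rule continuous_imp_measurable_on_sets_lebesgue) (auto intro!: continuous_intros cont)
    ultimately show ?thesis by (simp add: blinfun.diff_left)
  qed
  have "(\<lambda>t. \<psi> (?g t)) \<in> borel_measurable ?M"
    using measurable_compose[OF g lsc_borel_measurable[OF \<psi>(2)]] .
  then have "?f \<in> borel_measurable ?M"
    unfolding BE_integrand_def
    using conjugate_borel_measurable[of \<psi> ?w, OF \<psi>(1) w] blinfun_apply_borel_measurable[OF w g]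
    by (intro borel_measurable_ereal_diff borel_measurable_ereal_add borel_measurable_ereal)
  then have "(\<lambda>t. e2ennreal (?f t)) \<in> borel_measurable ?M" by measurable
  from nn_integral_0_iff_AE[OF this] int0 have "AE t in ?M. e2ennreal (?f t) = 0" by simp
  then show "AE t in ?M. ?f t \<le> 0"
    by eventually_elim (metis e2ennreal_enn2ereal enn2ereal_e2ennreal linear zero_ennreal.rep_eq order_refl)
qed

lemma energy_diff_le_BE_functional:
  fixes \<psi> :: "'a::{banach, second_countable_topology} \<Rightarrow> ereal"
  assumes \<psi>: "\<And>v. 0 \<le> \<psi> v" "proper \<psi>" "lower_semicontinuous \<psi>" "pos_homogeneous \<psi>"
    and sym: "symmetric_op A"
    and chi: "\<And>x. chi A x \<ge> 0" "\<And>x. chi A x = 0 \<longleftrightarrow> x = 0"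
    and l: "l \<in> Linf T" and y: "y \<in> W11 T"
    and zero: "BE_functional T \<psi> A l y0 y = 0"
    and v: "v \<in> W11 T" and t: "t \<in> {0..T}"
  shows "ereal (energy A (y t - v t)) \<le> BE_functional T \<psi> A l y0 v"
proof -
  let ?M = "lebesgue_on {0..T}"
  let ?f = "\<lambda>s. BE_integrand \<psi> (l s - blinfun_apply A (v s)) (W11_deriv T v s)"
  define d where
    "d = (\<lambda>s. blinfun_apply (blinfun_apply A (y s - v s)) (W11_deriv T y s - W11_deriv T v s))"
  note y_zero = BE_functional_eq_0[OF \<psi>(1,3) chi l y zero]
  have "AE s in ?M. ereal (d s) \<le> ?f s"
    using y_zero(2)
  proof eventually_elim
    case (elim s)
    from BE_integrand_ge[OF \<psi>(1,2,4) elim, of "l s - blinfun_apply A (v s)" "W11_deriv T v s"]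
    show ?case by (simp add: d_def blinfun.diff_right)
  qed
  then have ae: "AE s in ?M. ennreal (d s) \<le> e2ennreal (?f s)"
    by eventually_elim (metis e2ennreal_ereal e2ennreal_mono)
  have "is_W11_deriv T (\<lambda>s. y s - v s) (\<lambda>s. W11_deriv T y s - W11_deriv T v s)"
    using y v by (intro is_W11_deriv_diff W11_deriv_spec)
  note chain = energy_chain_rule[OF sym this t, folded d_def]
  have t_le: "t \<le> T" using t by simp
  \<comment> \<open>The integral of \<open>d\<close> may be negative; it then lies below its
    truncation 0.\<close>
  have "ereal (\<integral>s. d s \<partial>lebesgue_on {0..t}) \<le> enn2ereal (ennreal (\<integral>s. d s \<partial>lebesgue_on {0..t}))"
    by (cases "0 \<le> (\<integral>s. d s \<partial>lebesgue_on {0..t})") (auto intro: order_trans[OF _ enn2ereal_nonneg])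
  also have "\<dots> \<le> enn2ereal (\<integral>\<^sup>+s. ennreal (d s) \<partial>lebesgue_on {0..t})"
  proof -
    \<comment> \<open>The positive part of \<open>d\<close> links the Bochner integral to the
      nonnegative integral, since \<open>ennreal\<close> discards the negative part anyway.\<close>
    have "ennreal (\<integral>s. d s \<partial>lebesgue_on {0..t}) \<le> ennreal (\<integral>s. max 0 (d s) \<partial>lebesgue_on {0..t})"
      using chain(1) by (intro ennreal_leI integral_mono) auto
    also have "\<dots> = (\<integral>\<^sup>+s. ennreal (max 0 (d s)) \<partial>lebesgue_on {0..t})"
      using chain(1) by (intro nn_integral_eq_integral[symmetric]) auto
    finally show ?thesis
      unfolding less_eq_ennreal.rep_eq[symmetric] by (simp add: ennreal_max_0)
  qed
  also have "\<dots> \<le> enn2ereal (\<integral>\<^sup>+s. e2ennreal (?f s) \<partial>?M)"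
  proof -
    have "(\<integral>\<^sup>+s. ennreal (d s) \<partial>lebesgue_on {0..t}) = (\<integral>\<^sup>+s. ennreal (d s) * indicator {0..t} s \<partial>?M)"
      unfolding lebesgue_on_restrict[OF t_le]
      by (rule nn_integral_restrict_space) (auto simp: sets_restrict_space_iff)
    also have "\<dots> \<le> (\<integral>\<^sup>+s. e2ennreal (?f s) \<partial>?M)"
      by (rule nn_integral_mono_AE) (use ae in \<open>eventually_elim, auto simp: indicator_def\<close>)
    finally show ?thesis by (simp add: less_eq_ennreal.rep_eq)
  qed
  finally have int: "ereal (\<integral>s. d s \<partial>lebesgue_on {0..t}) \<le> enn2ereal (\<integral>\<^sup>+s. e2ennreal (?f s) \<partial>?M)" .
  \<comment> \<open>The quadratic energy is even, and \<open>chi\<close> exceeds it by a squared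
    norm.\<close>
  have "energy A (y 0 - v 0) = energy A (v 0 - y0)"
    unfolding y_zero(1) energy_def by (simp add: blinfun.diff_left blinfun.diff_right)
  also have "\<dots> \<le> chi A (v 0 - y0)" by (simp add: chi_def)
  finally have init: "energy A (y 0 - v 0) \<le> chi A (v 0 - y0)" .
  have "ereal (energy A (y t - v t)) =
      ereal (\<integral>s. d s \<partial>lebesgue_on {0..t}) + ereal (energy A (y 0 - v 0))"
    using chain(2) by simp
  also have "\<dots> \<le> enn2ereal (\<integral>\<^sup>+s. e2ennreal (?f s) \<partial>?M) + ereal (chi A (v 0 - y0))"
    using int init by (intro add_mono) auto
  finally show ?thesis unfolding BE_functional_def BE_integrand_def .
qed

theorem corollary4p5:
  fixes T \<alpha> :: real
    and \<psi> :: "'a::{banach, second_countable_topology} \<Rightarrow> ereal"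
    and A :: "'a \<Rightarrow>\<^sub>L ('a \<Rightarrow>\<^sub>L real)"
    and l :: "real \<Rightarrow> ('a \<Rightarrow>\<^sub>L real)"
    and y0 :: 'a
    and y :: "real \<Rightarrow> 'a"
  assumes "T > 0"
    and "reflexive_banach TYPE('a)"
    and "\<And>x. 0 \<le> \<psi> x"
    and "proper \<psi>"
    and "ereal_convex \<psi>"
    and "lower_semicontinuous \<psi>"
    and "pos_homogeneous \<psi>"
    and "symmetric_op A"
    and "\<alpha> > 0"
    and "\<And>x. x \<in> eff_dom \<psi> \<Longrightarrow> energy A x \<ge> \<alpha> / 2 * (norm x)\<^sup>2"
    and "\<And>x. chi A x \<ge> 0"
    and "\<And>x. chi A x = 0 \<longleftrightarrow> x = 0"
    and "l \<in> Linf T"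
    and "y0 \<in> eff_dom \<psi>"
    and "y \<in> W11 T"
    and "BE_functional T \<psi> A l y0 y = 0"
  shows "\<forall>v \<in> W11 T.
           \<exists>t0\<in>{0..T}. (\<forall>t\<in>{0..T}. energy A (y t - v t) \<le> energy A (y t0 - v t0)) \<and>
             ereal (energy A (y t0 - v t0)) \<le> BE_functional T \<psi> A l y0 v"
proof
  fix v :: "real \<Rightarrow> 'a" assume v: "v \<in> W11 T"
  \<comment> \<open>The maximum is attained because the energy of the continuous curve
    \<open>y - v\<close> is continuous on a compact interval; the bound at an arbitrary time then
    applies at the maximizer.\<close>
  have "continuous_on {0..T} (\<lambda>t. energy A (y t - v t))"
    using is_W11_deriv_continuous_on[OF W11_deriv_spec] \<open>y \<in> W11 T\<close> v
    unfolding energy_def by (intro continuous_intros) auto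
  moreover have "compact {0..T}" "{0..T} \<noteq> {}" using \<open>T > 0\<close> by auto
  ultimately obtain t0 where "t0 \<in> {0..T}"
      "\<forall>t\<in>{0..T}. energy A (y t - v t) \<le> energy A (y t0 - v t0)"
    using continuous_attains_sup by blast
  moreover from this(1) have "ereal (energy A (y t0 - v t0)) \<le> BE_functional T \<psi> A l y0 v"
    by (rule energy_diff_le_BE_functional[OF assms(3,4,6-8,11-13,15,16) v])
  ultimately show "\<exists>t0\<in>{0..T}. (\<forall>t\<in>{0..T}. energy A (y t - v t) \<le> energy A (y t0 - v t0)) \<and>
      ereal (energy A (y t0 - v t0)) \<le> BE_functional T \<psi> A l y0 v"
    by blast
qed

end
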